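(* Let $\mathbf{D}=(\mathbf{d},T)\in\mathbb{N}^n\times\mathbb{N}_{>0}$ with $M=\sum_i d_i$ even, and let $G$ be the temporal multigraph output by the temporal configuration model on input $\mathbf{D}$. Then $G$ is uniformly distributed in the set $\mathcal{S}(\mathbf{W}(G))\subseteq\mathcal{M}(\mathbf{D})$; that is, for any two temporal multigraphs $G_1,G_2\in\mathcal{M}(\mathbf{D})$ with $\mathbf{W}(G_1)=\mathbf{W}(G_2)$, the model outputs $G_1$ and $G_2$ with equal probability.
   Context: A temporal multigraph on nodes $V=\{v_1,\dots,v_n\}$ is a multiset of edges $(\{v_i,v_j\},t)$ with $t\in\mathbb{N}_{>0}$ ($i=j$ allowed, giving a loop). It matches $\mathbf{D}=(\mathbf{d},T)$ if all timestamps lie in $[1,T]$ and each $v_i$ has degree $d_i$ (summed over all timestamps, a loop contributing $2$). $\mathcal{M}(\mathbf{D})$ is the set of temporal multigraphs matching $\mathbf{D}$. Temporal configuration model: put $d_i$ marbles labeled $i$ into an urn for each $i$; starting from the empty graph on $V$, repeat until the urn is empty: draw two marbles uniformly at random without replacement, with labels $i,j$; draw $t$ uniformly at random from $[1,T]$; add the edge $(\{v_i,v_j\},t)$. For nodes $v_i,v_j$ and timestamp $t$, $w_{i,j,t}$ is the number of edges between $v_i$ and $v_j$ with timestamp $t$ (for $i=j$ write $w_{i,t}$ for the number of loops at $v_i$ with timestamp $t$). $\mathbf{W}(G)$ is the $n\times n\times T$ tensor with $\mathbf{W}_{i,j,t}(G)=w_{i,j,t}$ if $i\neq j$ and $w_{i,j,t}\ge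 2$, $\mathbf{W}_{i,j,t}(G)=0$ if $i\neq j$ and $w_{i,j,t}\le 1$, and $\mathbf{W}_{i,i,t}(G)=w_{i,t}$. For a tensor $\mathbf{W}$, $\mathcal{S}(\mathbf{W})=\{G\in\mathcal{M}(\mathbf{D}):\mathbf{W}(G)=\mathbf{W}\}$. *)

theory Defs
  imports "HOL-Probability.Probability" "HOL-Library.Multiset"
begin

text \<open>Nodes are the indices in \<open>{1..n}\<close>. An edge is a pair of the set of its endpoints and a
  timestamp, so a loop at \<open>i\<close> has the endpoint set \<open>{i, i} = {i}\<close>.\<close>

type_synonym temporal_edge = "nat set \<times> nat"

definition temporal_multigraph :: "nat \<Rightarrow> temporal_edge multiset \<Rightarrow> bool" where
  "temporal_multigraph n G \<longleftrightarrow>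
     (\<forall>(e, t) \<in># G. (\<exists>i\<in>{1..n}. \<exists>j\<in>{1..n}. e = {i, j}) \<and> t > 0)"

text \<open>The second summand makes a loop contribute 2.\<close>

definition node_degree :: "temporal_edge multiset \<Rightarrow> nat \<Rightarrow> nat" where
  "node_degree G v = size {#(e, t) \<in># G. v \<in> e#} + size {#(e, t) \<in># G. e = {v}#}"

definition matching_multigraphs ::
    "nat \<Rightarrow> (nat \<Rightarrow> nat) \<Rightarrow> nat \<Rightarrow> temporal_edge multiset set" where
  "matching_multigraphs n d T =
     {G. temporal_multigraph n G \<and>
         (\<forall>(e, t) \<in># G. t \<in> {1..T}) \<and>
         (\<forall>i\<in>{1..n}. node_degree G i = d i)}"

definition urn :: "nat \<Rightarrow> (nat \<Rightarrow> nat) \<Rightarrow> nat multiset" where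
  "urn n d = (\<Sum>i\<in>{1..n}. replicate_mset (d i) i)"

text \<open>The second marble is drawn from the urn with the first one removed. For an urn with an even
  number of marbles no draw is made from an empty urn.\<close>

function draw_edges ::
    "nat \<Rightarrow> nat multiset \<Rightarrow> temporal_edge multiset \<Rightarrow> temporal_edge multiset pmf" where
  "draw_edges T U G =
     (if U = {#} then return_pmf G
      else do {
        i \<leftarrow> pmf_of_multiset U;
        j \<leftarrow> pmf_of_multiset (U - {#i#});
        t \<leftarrow> pmf_of_set {1..T};
        draw_edges T (U - {#i, j#}) (add_mset ({i, j}, t) G)
      })"
  by auto
termination
proof (relation "Wellfounded.measure (\<lambda>(T, U, G). size U)", goal_cases)
  case (2 T U G i j t)
  then have "i \<in># U"
    by simp
  then have "size (U - {#i#}) < size U"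
    by (rule size_Diff1_less)
  moreover have "size (U - {#i, j#}) \<le> size (U - {#i#})"
    by (rule size_mset_mono) (simp add: subseteq_mset_def)
  ultimately show ?case
    by simp
qed simp

declare draw_edges.simps [simp del]

definition temporal_configuration_model ::
    "nat \<Rightarrow> (nat \<Rightarrow> nat) \<Rightarrow> nat \<Rightarrow> temporal_edge multiset pmf" where
  "temporal_configuration_model n d T = draw_edges T (urn n d) {#}"

definition edge_mult :: "temporal_edge multiset \<Rightarrow> nat \<Rightarrow> nat \<Rightarrow> nat \<Rightarrow> nat" where
  "edge_mult G i j t = count G ({i, j}, t)"

text \<open>An \<open>n \<times> n \<times> T\<close> tensor is a function that vanishes outside the index range, so that equality of
  functions is equality of tensors.\<close>

definition multi_tensor ::
    "nat \<Rightarrow> nat \<Rightarrow> temporal_edge multiset \<Rightarrow> nat \<Rightarrow> nat \<Rightarrow> nat \<Rightarrow> nat" where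
  "multi_tensor n T G i j t =
     (if i \<in> {1..n} \<and> j \<in> {1..n} \<and> t \<in> {1..T} then
        (if i = j then edge_mult G i i t
         else if edge_mult G i j t \<ge> 2 then edge_mult G i j t
         else 0)
      else 0)"

definition tensor_class ::
    "nat \<Rightarrow> (nat \<Rightarrow> nat) \<Rightarrow> nat \<Rightarrow> (nat \<Rightarrow> nat \<Rightarrow> nat \<Rightarrow> nat) \<Rightarrow> temporal_edge multiset set" where
  "tensor_class n d T W = {G \<in> matching_multigraphs n d T. multi_tensor n T G = W}"

end

theory Submission
  imports Defs
begin

text \<open>The output probability has a closed form. If \<open>H\<close> has \<open>m\<close> edges, of which \<open>l\<close> are not loops,
  and its endpoints use up the urn \<open>U\<close> with marble multiplicities \<open>d\<^sub>i\<close>, then \<open>H\<close> is drawn with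
  probability \<open>(\<Prod>i. d\<^sub>i!) m! 2\<^sup>l / ((2m)! T\<^sup>m \<Prod>e. w\<^sub>e!)\<close>, where \<open>w\<^sub>e\<close> is the multiplicity of the edge
  \<open>e\<close> with its timestamp. The proof is an induction on the urn that conditions on the first draw.
  The numbers \<open>m\<close> and \<open>d\<^sub>i\<close> are fixed by the degrees, the tensor determines the loops and hence \<open>l\<close>,
  and it determines all \<open>w\<^sub>e\<close> except that it confuses 0 with 1, where \<open>0! = 1!\<close>.\<close>

section \<open>Products of factorials of multiplicities\<close>

definition fact_count :: "'a multiset \<Rightarrow> nat" where
  "fact_count A = (\<Prod>x\<in>set_mset A. fact (count A x))"

lemma fact_count_empty [simp]: "fact_count {#} = 1"
  by (simp add: fact_count_def)

lemma fact_count_add_mset: "fact_count (add_mset x A) = (count A x + 1) * fact_count A"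
proof -
  \<comment> \<open>Both products are split over the common index set
    \<open>set_mset A - {x}\<close>, on which the multiplicities agree. If \<open>x\<close> is not
    in \<open>A\<close>, its factor for \<open>A\<close> is 0! = 1.\<close>
  have "fact_count B = fact (count B x) * (\<Prod>y\<in>set_mset A - {x}. fact (count A y))"
    if "B = A \<or> B = add_mset x A" for B
  proof -
    have "fact_count B = (\<Prod>y\<in>insert x (set_mset A). fact (count B y))"
      unfolding fact_count_def
      by (rule prod.mono_neutral_left) (use that in \<open>auto simp: not_in_iff\<close>)
    also have "\<dots> = fact (count B x) * (\<Prod>y\<in>set_mset A - {x}. fact (count B y))"
      by (rule prod.insert_remove) simp
    also have "(\<Prod>y\<in>set_mset A - {x}. fact (count B y)) =
        (\<Prod>y\<in>set_mset A - {x}. fact (count A y) :: nat)"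
      by (rule prod.cong) (use that in auto)
    finally show ?thesis .
  qed
  from this[of A] this[of "add_mset x A"] show ?thesis
    by (simp add: algebra_simps)
qed

lemma fact_count_pos: "fact_count A > 0"
  by (simp add: fact_count_def prod_pos)

text \<open>The supports may differ, since multiplicities 0 and 1 have the same factorial. Both
  products extend to the union of the supports by factors 0! = 1.\<close>

lemma fact_count_cong:
  assumes "\<And>x. (fact (count A x) :: nat) = fact (count B x)"
  shows "fact_count A = fact_count B"
proof -
  have "fact_count C = (\<Prod>x\<in>set_mset A \<union> set_mset B. fact (count C x))"
    if "C = A \<or> C = B" for C
    unfolding fact_count_def
    by (rule prod.mono_neutral_left) (use that in \<open>auto simp: not_in_iff\<close>)
  then show ?thesis
    using assms by auto
qed

section \<open>Edges, their endpoints and the weight of a multigraph\<close>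

text \<open>The nodes are left unbounded here: the range 1 to n is enforced later by requiring that
  the endpoints form the urn.\<close>

definition timed_edges :: "nat \<Rightarrow> temporal_edge set" where
  "timed_edges T = {({i, j}, t) | i j t. t \<in> {1..T}}"

definition is_loop :: "temporal_edge \<Rightarrow> bool" where
  "is_loop x \<longleftrightarrow> card (fst x) = 1"

text \<open>These are the two marbles whose draw creates the edge. A loop has a singleton as its
  endpoint set, hence the doubling.\<close>

definition endpoints :: "temporal_edge \<Rightarrow> nat multiset" where
  "endpoints x = (if is_loop x then mset_set (fst x) + mset_set (fst x) else mset_set (fst x))"

definition all_endpoints :: "temporal_edge multiset \<Rightarrow> nat multiset" where
  "all_endpoints H = (\<Sum>x\<in>#H. endpoints x)"

lemma is_loop_pair [simp]: "is_loop ({i, j}, t) \<longleftrightarrow> i = j"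
  by (auto simp: is_loop_def card_insert_if)

lemma endpoints_pair [simp]: "endpoints ({i, j}, t) = {#i, j#}"
  by (cases "i = j") (auto simp: endpoints_def is_loop_def)

lemma endpoints_loop: "endpoints ({i}, t) = {#i, i#}"
  using endpoints_pair[of i i t] by simp

lemma all_endpoints_empty [simp]: "all_endpoints {#} = {#}"
  by (simp add: all_endpoints_def)

lemma all_endpoints_add_mset [simp]:
  "all_endpoints (add_mset x H) = endpoints x + all_endpoints H"
  by (simp add: all_endpoints_def)

lemma size_all_endpoints:
  "set_mset H \<subseteq> timed_edges T \<Longrightarrow> size (all_endpoints H) = 2 * size H"
  by (induction H) (auto simp: timed_edges_def)

lemma count_all_endpoints:
  "set_mset H \<subseteq> timed_edges T \<Longrightarrow> count (all_endpoints H) v = node_degree H v"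
  by (induction H) (auto simp: timed_edges_def node_degree_def doubleton_eq_iff endpoints_loop split: if_splits)

text \<open>The factor of the closed form that depends on more than the urn, \<open>T\<close> and
  the number of edges.\<close>

definition weight :: "temporal_edge multiset \<Rightarrow> real" where
  "weight H = 2 ^ size {#x \<in># H. \<not> is_loop x#} / real (fact_count H)"

lemma weight_pos: "weight H > 0"
  by (simp add: weight_def fact_count_pos)

lemma weight_add_mset:
  "weight H = weight (add_mset x H) * real (count (add_mset x H) x) / (if is_loop x then 1 else 2)"
proof -
  define c where "c = real (count (add_mset x H) x)"
  have "real (fact_count (add_mset x H)) = c * real (fact_count H)"
    by (simp add: fact_count_add_mset c_def algebra_simps)
  moreover have "c > 0" "real (fact_count H) > 0"
    using fact_count_pos[of H] by (auto simp: c_def)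
  ultimately show ?thesis
    unfolding c_def[symmetric] by (simp add: weight_def)
qed

lemma weight_remove:
  assumes "x \<in># H"
  shows "weight (H - {#x#}) = weight H * real (count H x) / (if is_loop x then 1 else 2)"
  using weight_add_mset[of "H - {#x#}" x] assms by simp

text \<open>Every edge that is not a loop arises from two ordered pairs of marbles, a loop from one.\<close>

lemma sum_ordered_pairs_count:
  assumes "set_mset H \<subseteq> timed_edges T" "set_mset (all_endpoints H) \<subseteq> A" "finite A"
  shows "(\<Sum>i\<in>A. \<Sum>j\<in>A. \<Sum>t\<in>{1..T}.
            real (count H ({i, j}, t)) / (if i = j then 1 else 2)) = real (size H)"
  using assms(1,2)
proof (induction H)
  case (add x H)
  then obtain a b s where x: "x = ({a, b}, s)" and s: "s \<in> {1..T}"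
    by (auto simp: timed_edges_def)
  have ab: "a \<in> A" "b \<in> A"
    using add.prems by (auto simp: x)
  define c :: "nat \<Rightarrow> nat \<Rightarrow> real" where "c i j = (if i = j then 1 else 2)" for i j
  \<comment> \<open>This is the growth of the sum caused by the new edge \<open>x\<close>. Its
    timestamp is fixed, so only the ordered pairs (a, b) and (b, a) remain.\<close>
  have "(\<Sum>i\<in>A. \<Sum>j\<in>A. \<Sum>t\<in>{1..T}. (if ({i, j}, t) = x then 1 / c i j else 0)) =
        (\<Sum>i\<in>A. \<Sum>j\<in>A. if {i, j} = {a, b} then 1 / c i j else 0)"
    by (intro sum.cong refl) (use s in \<open>auto simp: x\<close>)
  also have "\<dots> = (\<Sum>p\<in>A \<times> A. if p \<in> {(a, b), (b, a)} then 1 / c (fst p) (snd p) else 0)"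
    by (subst sum.cartesian_product, rule sum.cong) (auto simp: doubleton_eq_iff split: if_splits)
  also have "\<dots> = (\<Sum>p\<in>A \<times> A \<inter> {(a, b), (b, a)}. 1 / c (fst p) (snd p))"
    by (rule sum.inter_restrict[symmetric]) (use assms(3) in simp)
  also have "A \<times> A \<inter> {(a, b), (b, a)} = {(a, b), (b, a)}"
    using ab by auto
  also have "(\<Sum>p\<in>{(a, b), (b, a)}. 1 / c (fst p) (snd p)) = 1"
    by (cases "a = b") (auto simp: c_def)
  finally have new:
    "(\<Sum>i\<in>A. \<Sum>j\<in>A. \<Sum>t\<in>{1..T}. (if ({i, j}, t) = x then 1 / c i j else 0)) = 1" .
  have IH: "(\<Sum>i\<in>A. \<Sum>j\<in>A. \<Sum>t\<in>{1..T}. real (count H ({i, j}, t)) / c i j) = real (size H)"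
    using add by (simp add: c_def)
  have "(\<Sum>i\<in>A. \<Sum>j\<in>A. \<Sum>t\<in>{1..T}. real (count (add_mset x H) ({i, j}, t)) / c i j) =
        (\<Sum>i\<in>A. \<Sum>j\<in>A. \<Sum>t\<in>{1..T}. real (count H ({i, j}, t)) / c i j +
           (if ({i, j}, t) = x then 1 / c i j else 0))"
    by (intro sum.cong refl) (auto simp: add_divide_distrib)
  also have "\<dots> = real (size H) + 1"
    by (simp only: sum.distrib IH new)
  finally show ?case
    by (simp add: c_def)
qed simp

text \<open>The induction on the urn needs the total weight of what remains of \<open>H\<close>
  after each possible first draw. The factor \<open>size H\<close> obtained here turns (m - 1)! into
  m!.\<close>

lemma sum_ordered_pairs_weight:
  assumes "set_mset H \<subseteq> timed_edges T" "set_mset (all_endpoints H) \<subseteq> A" "finite A"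
  shows "(\<Sum>i\<in>A. \<Sum>j\<in>A. \<Sum>t\<in>{1..T}.
            if ({i, j}, t) \<in># H then weight (H - {#({i, j}, t)#}) else 0) = real (size H) * weight H"
proof -
  have "(\<Sum>i\<in>A. \<Sum>j\<in>A. \<Sum>t\<in>{1..T}.
            if ({i, j}, t) \<in># H then weight (H - {#({i, j}, t)#}) else 0) =
        (\<Sum>i\<in>A. \<Sum>j\<in>A. \<Sum>t\<in>{1..T}.
            weight H * (real (count H ({i, j}, t)) / (if i = j then 1 else 2)))"
    by (intro sum.cong refl) (auto simp: weight_remove not_in_iff)
  also have "\<dots> = weight H * real (size H)"
    by (simp only: sum_distrib_left[symmetric] sum_ordered_pairs_count[OF assms])
  finally show ?thesis
    by simp
qed

section \<open>The drawing process and its recursion\<close>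

lemma size_remove_pair_less:
  assumes "i \<in># U"
  shows "size (U - {#i, j#}) < size U"
proof -
  have "size (U - {#i, j#}) \<le> size (U - {#i#})"
    by (rule size_mset_mono) (simp add: subseteq_mset_def)
  then show ?thesis
    using size_Diff1_less[OF assms] by simp
qed

text \<open>The edges collected so far never influence a draw. Hence every run can be related to one
  that starts from the empty graph, which is the form the recursion needs.\<close>

lemma draw_edges_accumulator: "draw_edges T U G = map_pmf ((+) G) (draw_edges T U {#})"
proof (induction "size U" arbitrary: U G rule: less_induct)
  case less
  show ?case
  proof (cases "U = {#}")
    case True
    then show ?thesis
      by (simp add: draw_edges.simps)
  next
    case False
    have "draw_edges T (U - {#i, j#}) (add_mset x G) =
          map_pmf ((+) G) (draw_edges T (U - {#i, j#}) {#x#})" if "i \<in># U" for i j x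
    proof -
      have "(+) (add_mset x G) = (+) G \<circ> (+) {#x#}"
        by auto
      then show ?thesis
        unfolding less[OF size_remove_pair_less[OF that], of j "add_mset x G"]
            less[OF size_remove_pair_less[OF that], of j "{#x#}"]
        by (simp only: pmf.map_comp)
    qed
    then show ?thesis
      unfolding draw_edges.simps[of T U] map_bind_pmf
      using False by (auto simp: map_bind_pmf intro!: bind_pmf_cong)
  qed
qed

lemma draw_edges_single:
  "draw_edges T U {#x#} = map_pmf (add_mset x) (draw_edges T U {#})"
proof -
  have "(+) {#x#} = add_mset x"
    by auto
  then show ?thesis
    using draw_edges_accumulator[of T U "{#x#}"] by simp
qed

lemma finite_set_pmf_draw_edges:
  assumes "even (size U)" "T > 0"
  shows "finite (set_pmf (draw_edges T U G))"
  using assms(1)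
proof (induction "size U" arbitrary: U G rule: less_induct)
  case less
  show ?case
  proof (cases "U = {#}")
    case True
    then show ?thesis
      by (simp add: draw_edges.simps)
  next
    case False
    have "finite (set_pmf (draw_edges T (U - {#i, j#}) G'))"
      if "i \<in># U" "j \<in># U - {#i#}" for i j G'
    proof (rule less.hyps)
      show "size (U - {#i, j#}) < size U"
        by (rule size_remove_pair_less) fact
      show "even (size (U - {#i, j#}))"
      proof -
        have "add_mset i (add_mset j (U - {#i#} - {#j#})) = U"
          by (simp only: insert_DiffM that)
        then obtain V where "U = {#i, j#} + V"
          by (metis add_mset_add_single union_mset_add_mset_left add_0)
        then show ?thesis
          using less.prems by simp
      qed
    qed
    \<comment> \<open>A nonempty urn of even size has at least two marbles, so the second draw is
      also from a nonempty urn.\<close>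
    moreover have "U - {#i#} \<noteq> {#}" if "i \<in># U" for i
      using that less.prems by (metis insert_DiffM size_single even_Suc even_zero One_nat_def)
    ultimately show ?thesis
      using False \<open>T > 0\<close> by (subst draw_edges.simps) auto
  qed
qed

lemma pmf_map_add_mset:
  "pmf (map_pmf (add_mset x) p) H = (if x \<in># H then pmf p (H - {#x#}) else 0)"
proof (cases "x \<in># H")
  case True
  then have "pmf (map_pmf (add_mset x) p) H = pmf (map_pmf (add_mset x) p) (add_mset x (H - {#x#}))"
    by simp
  also have "\<dots> = pmf p (H - {#x#})"
    by (rule pmf_map_inj') (simp add: inj_def)
  finally show ?thesis
    using True by simp
next
  case False
  then show ?thesis
    by (auto intro: pmf_map_outside)
qed

lemma pmf_bind_sum:
  assumes "finite A" "set_pmf p \<subseteq> A"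
  shows "pmf (bind_pmf p f) x = (\<Sum>a\<in>A. pmf p a * pmf (f a) x)"
  unfolding pmf_bind by (subst integral_measure_pmf[of A]) (use assms in auto)

text \<open>Conditioning on the first two marbles and the timestamp. The second marble ranges over
  all of \<open>set_mset U\<close>, so that its index set does not depend on \<open>i\<close>; a
  label absent from \<open>U - {#i#}\<close> has count 0 and adds nothing.\<close>

lemma pmf_draw_edges_rec:
  assumes "size U \<ge> 2" "T > 0"
  shows "pmf (draw_edges T U {#}) H =
    (\<Sum>i\<in>set_mset U. \<Sum>j\<in>set_mset U. \<Sum>t\<in>{1..T}.
       real (count U i) / real (size U) * (real (count (U - {#i#}) j) / real (size U - 1)) *
       (1 / real T) *
       (if ({i, j}, t) \<in># H
        then pmf (draw_edges T (U - {#i, j#}) {#}) (H - {#({i, j}, t)#}) else 0))"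
proof -
  have ne: "U \<noteq> {#}"
    using assms by auto
  have ne': "U - {#i#} \<noteq> {#}" if "i \<in># U" for i
    using that assms(1) by (metis insert_DiffM size_single Suc_1 not_less_eq_eq One_nat_def order_refl)
  have inner: "pmf (bind_pmf (pmf_of_set {1..T}) (\<lambda>t. draw_edges T V {#({i, j}, t)#})) H =
     (\<Sum>t\<in>{1..T}. 1 / real T *
        (if ({i, j}, t) \<in># H then pmf (draw_edges T V {#}) (H - {#({i, j}, t)#}) else 0))"
    for V i j
    by (subst pmf_bind_sum[of "{1..T}"])
       (use assms(2) in \<open>auto simp: draw_edges_single pmf_map_add_mset intro!: sum.cong\<close>)
  have "pmf (draw_edges T U {#}) H =
    (\<Sum>i\<in>set_mset U. pmf (pmf_of_multiset U) i * pmf (do {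
        j \<leftarrow> pmf_of_multiset (U - {#i#});
        t \<leftarrow> pmf_of_set {1..T};
        draw_edges T (U - {#i, j#}) {#({i, j}, t)#}
      }) H)"
    by (subst draw_edges.simps) (use ne in \<open>simp add: pmf_bind_sum[of "set_mset U"]\<close>)
  also have "\<dots> = (\<Sum>i\<in>set_mset U. real (count U i) / real (size U) *
      (\<Sum>j\<in>set_mset U. real (count (U - {#i#}) j) / real (size U - 1) *
        (\<Sum>t\<in>{1..T}. 1 / real T * (if ({i, j}, t) \<in># H
        then pmf (draw_edges T (U - {#i, j#}) {#}) (H - {#({i, j}, t)#}) else 0))))"
  proof (intro sum.cong refl)
    fix i assume i: "i \<in># U"
    have sub: "set_pmf (pmf_of_multiset (U - {#i#})) \<subseteq> set_mset U"
      using ne'[OF i] by (auto dest: in_diffD)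
    show "pmf (pmf_of_multiset U) i * pmf (do {
        j \<leftarrow> pmf_of_multiset (U - {#i#});
        t \<leftarrow> pmf_of_set {1..T};
        draw_edges T (U - {#i, j#}) {#({i, j}, t)#}
      }) H = real (count U i) / real (size U) *
      (\<Sum>j\<in>set_mset U. real (count (U - {#i#}) j) / real (size U - 1) *
        (\<Sum>t\<in>{1..T}. 1 / real T * (if ({i, j}, t) \<in># H
        then pmf (draw_edges T (U - {#i, j#}) {#}) (H - {#({i, j}, t)#}) else 0)))"
      unfolding pmf_bind_sum[OF finite_set_mset sub] inner
      using ne ne'[OF i] i
      by (simp add: size_Diff_singleton del: diff_diff_add_mset count_diff)
  qed
  finally show ?thesis
    by (simp add: sum_distrib_left mult.assoc)
qed

section \<open>The closed form of the output probability\<close>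

lemma pmf_draw_edges:
  assumes "even (size U)" "T > 0"
  shows "pmf (draw_edges T U {#}) H =
    (if set_mset H \<subseteq> timed_edges T \<and> all_endpoints H = U
     then real (fact_count U) * fact (size H) / (fact (size U) * real T ^ size H) * weight H
     else 0)"
  using assms(1)
proof (induction "size U" arbitrary: U H rule: less_induct)
  case less
  show ?case
  proof (cases "U = {#}")
    case True
    \<comment> \<open>The endpoints number twice the edges, so only the empty multigraph fits the
      empty urn.\<close>
    moreover have "all_endpoints H \<noteq> {#}" if "set_mset H \<subseteq> timed_edges T" "H \<noteq> {#}"
      using size_all_endpoints[OF that(1)] that(2) by auto
    ultimately show ?thesis
      by (auto simp: draw_edges.simps weight_def pmf_return indicator_def)
  next
    case False
    with less.prems have size_U: "size U \<ge> 2"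
      by (metis One_nat_def Suc_1 Suc_leI even_Suc even_zero le_neq_implies_less nonempty_has_size)
    define valid where "valid \<longleftrightarrow> set_mset H \<subseteq> timed_edges T \<and> all_endpoints H = U"
    \<comment> \<open>The closed form with (m - 1)! for m! and without the weight. The probabilities
      of the two marbles and the timestamp are exactly the ratios by which
      \<open>fact_count\<close>, the factorial of the urn size and the power of \<open>T\<close>
      change when one edge is removed, so each summand is \<open>K\<close> times a weight.\<close>
    define K where "K = real (fact_count U) * fact (size H - 1) / (fact (size U) * real T ^ size H)"
    have summand:
      "real (count U i) / real (size U) * (real (count (U - {#i#}) j) / real (size U - 1)) *
       (1 / real T) *
       (if ({i, j}, t) \<in># H
        then pmf (draw_edges T (U - {#i, j#}) {#}) (H - {#({i, j}, t)#}) else 0) =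
       (if valid then K * (if ({i, j}, t) \<in># H then weight (H - {#({i, j}, t)#}) else 0) else 0)"
      (is "?l = ?r") if t: "t \<in> {1..T}" for i j t
    proof (cases "({i, j}, t) \<in># H")
      case True
      then obtain H' where H: "H = add_mset ({i, j}, t) H'"
        by (metis insert_DiffM)
      show ?thesis
      proof (cases "{#i, j#} \<subseteq># U")
        case True
        then obtain U' where U: "U = {#i, j#} + U'"
          by (metis subset_mset.add_diff_inverse)
        have "even (size U')" "size U' < size U"
          using less.prems by (auto simp: U)
        note IH = less.hyps[OF this(2,1)]
        have "set_mset H' \<subseteq> timed_edges T \<and> all_endpoints H' = U' \<longleftrightarrow> valid"
          using t by (auto simp: valid_def H U timed_edges_def)
        then have "pmf (draw_edges T U' {#}) H' = (if valid then
           real (fact_count U') * fact (size H') / (fact (size U') * real T ^ size H') * weight H'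
           else 0)"
          using IH[of H'] by simp
        then show ?thesis
          using assms(2)
          by (auto simp: H U K_def fact_count_add_mset field_simps)
      next
        case False
        \<comment> \<open>If the urn lacks the two marbles, the draw has probability 0, and no
          multigraph with this edge uses up the urn, so both sides vanish.\<close>
        then have "count U i = 0 \<or> count (U - {#i#}) j = 0"
          by (metis count_eq_zero_iff insert_DiffM mset_subset_eq_add_mset_cancel mset_subset_eq_single)
        then have "?l = 0"
          by auto
        moreover have "\<not> valid"
          using False by (auto simp: valid_def H)
        ultimately show ?thesis
          by simp
      qed
    qed simp
    have "pmf (draw_edges T U {#}) H =
       (\<Sum>i\<in>set_mset U. \<Sum>j\<in>set_mset U. \<Sum>t\<in>{1..T}.
       (if valid then K * (if ({i, j}, t) \<in># H then weight (H - {#({i, j}, t)#}) else 0) else 0))"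
      unfolding pmf_draw_edges_rec[OF size_U assms(2)]
      by (intro sum.cong refl summand)
    also have "\<dots> = (if valid then K * (real (size H) * weight H) else 0)"
    proof (cases valid)
      case True
      then show ?thesis
        using sum_ordered_pairs_weight[of H T "set_mset U"]
        by (simp add: valid_def sum_distrib_left[symmetric])
    qed simp
    also have "\<dots> = (if valid
      then real (fact_count U) * fact (size H) / (fact (size U) * real T ^ size H) * weight H else 0)"
    proof (cases valid)
      case True
      then have "H \<noteq> {#}"
        using False by (auto simp: valid_def)
      then have "size H > 0"
        by (simp add: nonempty_has_size[symmetric])
      then have "fact (size H) = real (size H) * fact (size H - 1)"
        by (rule fact_reduce)
      then show ?thesis
        by (simp add: K_def)
    qed simp
    finally show ?thesis
      unfolding valid_def .
  qed
qed

section \<open>Conditioning, matching multigraphs and the tensor\<close>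

text \<open>A distribution that is constant on the part of its support inside the event becomes
  uniform there. The event \<open>A\<close> may contain outcomes of probability 0, hence the
  intersection with the support.\<close>

lemma cond_pmf_eq_pmf_of_set:
  assumes S: "S = set_pmf p \<inter> A" "finite S" "S \<noteq> {}"
    and const: "\<And>x. x \<in> S \<Longrightarrow> pmf p x = c"
  shows "cond_pmf p A = pmf_of_set S"
proof (rule pmf_eqI)
  fix x
  have "measure (measure_pmf p) A = measure (measure_pmf p) S"
    by (metis S(1) measure_Int_set_pmf Int_commute)
  also have "\<dots> = real (card S) * c"
    using const S(2) by (simp add: measure_measure_pmf_finite)
  finally have meas: "measure (measure_pmf p) A = real (card S) * c" .
  obtain y where y: "y \<in> S"
    using S(3) by blast
  then have "c \<noteq> 0"
    using const[OF y] by (auto simp: S(1) set_pmf_iff)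
  have "set_pmf p \<inter> A \<noteq> {}"
    using S(1,3) by simp
  then have "pmf (cond_pmf p A) x = (if x \<in> A then pmf p x / (real (card S) * c) else 0)"
    by (simp add: pmf_cond meas)
  also have "\<dots> = (if x \<in> S then 1 / real (card S) else 0)"
    using const[of x] \<open>c \<noteq> 0\<close> by (auto simp: S(1) set_pmf_iff)
  also have "\<dots> = pmf (pmf_of_set S) x"
    using S(2,3) by (simp add: indicator_def)
  finally show "pmf (cond_pmf p A) x = pmf (pmf_of_set S) x" .
qed

lemma count_urn: "count (urn n d) v = (if v \<in> {1..n} then d v else 0)"
  by (simp add: urn_def count_sum)

lemma size_urn: "size (urn n d) = (\<Sum>i\<in>{1..n}. d i)"
  by (simp add: urn_def size_multiset_sum)

text \<open>Degrees count endpoints. A node outside 1 to n has degree 0 and no marble; conversely,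
  every endpoint of an edge occurs in the urn and so lies in that range.\<close>

lemma matching_multigraphs_iff:
  "H \<in> matching_multigraphs n d T \<longleftrightarrow> set_mset H \<subseteq> timed_edges T \<and> all_endpoints H = urn n d"
  (is "?l \<longleftrightarrow> ?r")
proof
  assume l: ?l
  then have valid: "set_mset H \<subseteq> timed_edges T"
    by (fastforce simp: matching_multigraphs_def temporal_multigraph_def timed_edges_def)
  have "count (all_endpoints H) v = count (urn n d) v" for v
  proof (cases "v \<in> {1..n}")
    case True
    then show ?thesis
      using l by (simp add: count_all_endpoints[OF valid] count_urn matching_multigraphs_def)
  next
    case False
    then have "v \<notin> fst x" if "x \<in># H" for x
      using l that by (fastforce simp: matching_multigraphs_def temporal_multigraph_def)
    then have "node_degree H v = 0"
      by (force simp: node_degree_def)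
    then show ?thesis
      using False by (simp only: count_all_endpoints[OF valid] count_urn if_False)
  qed
  with valid show ?r
    by (auto intro: multiset_eqI)
next
  assume r: ?r
  then have valid: "set_mset H \<subseteq> timed_edges T"
    by simp
  have nodes: "i \<in> {1..n} \<and> j \<in> {1..n}" if edge: "({i, j}, t) \<in># H" for i j t
  proof -
    obtain A where "H = add_mset ({i, j}, t) A"
      using multi_member_split[OF edge] by blast
    then have "urn n d = {#i, j#} + all_endpoints A"
      using r by simp
    then have "i \<in># urn n d" "j \<in># urn n d"
      by simp_all
    then show ?thesis
      by (metis count_urn not_in_iff)
  qed
  have "(\<exists>i\<in>{1..n}. \<exists>j\<in>{1..n}. e = {i, j}) \<and> t \<in> {1..T}" if "(e, t) \<in># H" for e t
  proof -
    obtain i j where "e = {i, j}" "t \<in> {1..T}"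
      using valid \<open>(e, t) \<in># H\<close> by (auto simp: timed_edges_def)
    then show ?thesis
      using nodes that by blast
  qed
  moreover have "node_degree H i = d i" if "i \<in> {1..n}" for i
    using r that by (simp add: count_all_endpoints[OF valid, symmetric] count_urn)
  ultimately show ?l
    by (fastforce simp: matching_multigraphs_def temporal_multigraph_def)
qed

lemma multi_tensor_determines:
  assumes G: "G \<in> matching_multigraphs n d T" and H: "H \<in> matching_multigraphs n d T"
    and eq: "multi_tensor n T G = multi_tensor n T H"
  shows "(fact (count G x) :: nat) = fact (count H x)"
    and "is_loop x \<Longrightarrow> count G x = count H x"
proof -
  have "(fact (count G x) :: nat) = fact (count H x) \<and> (is_loop x \<longrightarrow> count G x = count H x)"
  \<comment> \<open>An edge present in either multigraph has indices in the range where the tensor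
    is informative; any other edge has multiplicity 0 in both.\<close>
  proof (cases "x \<in># G \<or> x \<in># H")
    case True
    then obtain i j t where x: "x = ({i, j}, t)" and
      ij: "i \<in> {1..n}" "j \<in> {1..n}" "t \<in> {1..T}"
      using G H by (fastforce simp: matching_multigraphs_def temporal_multigraph_def)
    have small: "(fact k :: nat) = 1" if "k < 2" for k :: nat
      using that by (cases k) auto
    have "multi_tensor n T G i j t = multi_tensor n T H i j t"
      using eq by simp
    then show ?thesis
      using ij by (auto simp: multi_tensor_def edge_mult_def x small split: if_splits)
  next
    case False
    then show ?thesis
      by (simp add: not_in_iff)
  qed
  then show "(fact (count G x) :: nat) = fact (count H x)"
    and "is_loop x \<Longrightarrow> count G x = count H x"
    by auto
qed

lemma size_matching_multigraph:
  assumes "G \<in> matching_multigraphs n d T"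
  shows "2 * size G = (\<Sum>i\<in>{1..n}. d i)"
  using assms size_all_endpoints[of G T] by (simp add: matching_multigraphs_iff size_urn)

text \<open>The tensor does not record single edges that are not loops. Their contribution to the
  exponent of 2 is recovered by subtracting the loops, which it does record, from the total fixed by
  the degrees.\<close>

lemma weight_eq:
  assumes "G \<in> matching_multigraphs n d T" "H \<in> matching_multigraphs n d T"
    and "multi_tensor n T G = multi_tensor n T H"
  shows "weight G = weight H"
proof -
  have "{#x \<in># G. is_loop x#} = {#x \<in># H. is_loop x#}"
    by (rule multiset_eqI) (use multi_tensor_determines(2)[OF assms] in auto)
  moreover have "size G = size H"
    using assms(1,2)[THEN size_matching_multigraph] by simp
  moreover have "size G = size {#x \<in># G. is_loop x#} + size {#x \<in># G. \<not> is_loop x#}"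
    and "size H = size {#x \<in># H. is_loop x#} + size {#x \<in># H. \<not> is_loop x#}"
    by (metis multiset_partition size_union)+
  ultimately have "size {#x \<in># G. \<not> is_loop x#} = size {#x \<in># H. \<not> is_loop x#}"
    by simp
  then show ?thesis
    using fact_count_cong[OF multi_tensor_determines(1)[OF assms]] by (simp add: weight_def)
qed

section \<open>Uniformity within a tensor class\<close>

theorem theorem3:
  fixes n T :: nat and d :: "nat \<Rightarrow> nat"
  assumes "T > 0"
    and "even (\<Sum>i\<in>{1..n}. d i)"
  defines "P \<equiv> temporal_configuration_model n d T"
  shows "(\<forall>G\<in>set_pmf P.
            G \<in> tensor_class n d T (multi_tensor n T G) \<and>
            tensor_class n d T (multi_tensor n T G) \<subseteq> matching_multigraphs n d T \<and>
            cond_pmf P {H. multi_tensor n T H = multi_tensor n T G}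
              = pmf_of_set (tensor_class n d T (multi_tensor n T G))) \<and>
         (\<forall>G\<^sub>1\<in>matching_multigraphs n d T. \<forall>G\<^sub>2\<in>matching_multigraphs n d T.
            multi_tensor n T G\<^sub>1 = multi_tensor n T G\<^sub>2 \<longrightarrow> pmf P G\<^sub>1 = pmf P G\<^sub>2)"
proof -
  have even: "even (size (urn n d))"
    using assms(2) by (simp add: size_urn)
  have pmf_P: "pmf P H = (if H \<in> matching_multigraphs n d T
     then real (fact_count (urn n d)) * fact (size H) /
       (fact (size (urn n d)) * real T ^ size H) * weight H else 0)" for H
    unfolding P_def temporal_configuration_model_def matching_multigraphs_iff
    by (rule pmf_draw_edges[OF even assms(1)])
  \<comment> \<open>The closed form is positive, so every matching multigraph is a possible output.
    Finiteness of the classes then follows from that of the support.\<close>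
  have set_P: "set_pmf P = matching_multigraphs n d T"
  proof -
    have "H \<in> set_pmf P \<longleftrightarrow> H \<in> matching_multigraphs n d T" for H
    proof -
      have "weight H \<noteq> 0" "real (fact_count (urn n d)) \<noteq> 0"
        using weight_pos[of H] fact_count_pos[of "urn n d"] by linarith+
      then show ?thesis
        using assms(1) by (simp add: set_pmf_iff pmf_P)
    qed
    then show ?thesis
      by (rule set_eqI)
  qed
  have finite_P: "finite (set_pmf P)"
    unfolding P_def temporal_configuration_model_def
    by (rule finite_set_pmf_draw_edges[OF even assms(1)])
  have equal: "pmf P G = pmf P H"
    if "G \<in> matching_multigraphs n d T" "H \<in> matching_multigraphs n d T"
      "multi_tensor n T G = multi_tensor n T H" for G H
  proof -
    have "size G = size H"
      using that(1,2)[THEN size_matching_multigraph] by simp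
    then show ?thesis
      using that(1,2) weight_eq[OF that] by (simp add: pmf_P)
  qed
  have "cond_pmf P {H. multi_tensor n T H = multi_tensor n T G} =
        pmf_of_set (tensor_class n d T (multi_tensor n T G))" if "G \<in> set_pmf P" for G
  proof (rule cond_pmf_eq_pmf_of_set)
    show "tensor_class n d T (multi_tensor n T G) =
          set_pmf P \<inter> {H. multi_tensor n T H = multi_tensor n T G}"
      by (auto simp: set_P tensor_class_def)
    then show "finite (tensor_class n d T (multi_tensor n T G))"
      and "tensor_class n d T (multi_tensor n T G) \<noteq> {}"
      using finite_P that by auto
    show "pmf P H = pmf P G" if "H \<in> tensor_class n d T (multi_tensor n T G)" for H
      using that \<open>G \<in> set_pmf P\<close> by (intro equal) (auto simp: tensor_class_def set_P)
  qed
  moreover have "tensor_class n d T (multi_tensor n T G) \<subseteq> matching_multigraphs n d T"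
    and "G \<in> set_pmf P \<Longrightarrow> G \<in> tensor_class n d T (multi_tensor n T G)" for G
    by (auto simp: tensor_class_def set_P)
  ultimately show ?thesis
    using equal by blast
qed

end
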